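(* Let $G=(V,E)$ be a finite, connected and symmetric weighted graph with vertex measure $\mu$, let $h_+,h_-:V\to\mathbb{R}$ be functions with $h_+\not\equiv 0$ and $h_-\not\equiv 0$, and let $c\in\mathbb{R}$. Then the solutions of the sinh-Gordon equation $$-\Delta u=h_{+}e^{u}+h_{-}e^{-u}-c\quad\text{on } V$$ are uniformly bounded: there is a constant $C$ (independent of the solution) such that every solution $u:V\to\mathbb{R}$ satisfies $\max_{V}|u|\le C$.
   Context: A finite, connected and symmetric graph $G=(V,E)$ has a finite vertex set $V$ and symmetric edge weights $\omega_{xy}=\omega_{yx}\ge 0$ with $\omega_{xy}>0$ if and only if $x\sim y$ (i.e. $xy\in E$); connected means that any two vertices are joined by a path of edges. The vertex measure is a positive function $\mu:V\to(0,\infty)$, $x\mapsto\mu_x$. The Laplacian acting on $u:V\to\mathbb{R}$ is $$\Delta u(x)=\frac{1}{\mu_x}\sum_{y\sim x}\omega_{xy}\,(u(y)-u(x)).$$ *)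

theory Defs
  imports Complex_Main "Graph_Theory.Pair_Digraph" "Graph_Theory.Digraph_Component"
begin

text \<open>
  A \<open>pair_pseudo_graph\<close> is a finite graph without parallel edges whose edge relation
  \<open>parcs G\<close> is symmetric.  An edge \<open>xy\<close> is represented by both \<open>(x, y)\<close> and
  \<open>(y, x)\<close>.  Loops are not excluded; they do not contribute to the Laplacian.
  The weights and the measure are only constrained on the vertex set.
  The qualified name distinguishes graph connectedness from the topological notion.
\<close>

locale connected_weighted_graph = pair_pseudo_graph G
  for G :: "'v pair_pre_digraph" +
  fixes \<omega> :: "'v \<Rightarrow> 'v \<Rightarrow> real" and \<mu> :: "'v \<Rightarrow> real"
  assumes graph_connected: "Digraph_Component.connected (with_proj G)"
    and weight_sym: "\<And>x y. x \<in> pverts G \<Longrightarrow> y \<in> pverts G \<Longrightarrow> \<omega> x y = \<omega> y x"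
    and weight_nonneg: "\<And>x y. x \<in> pverts G \<Longrightarrow> y \<in> pverts G \<Longrightarrow> \<omega> x y \<ge> 0"
    and weight_pos_iff:
      "\<And>x y. x \<in> pverts G \<Longrightarrow> y \<in> pverts G \<Longrightarrow> \<omega> x y > 0 \<longleftrightarrow> (x, y) \<in> parcs G"
    and measure_pos: "\<And>x. x \<in> pverts G \<Longrightarrow> \<mu> x > 0"

definition laplacian ::
  "'v pair_pre_digraph \<Rightarrow> ('v \<Rightarrow> 'v \<Rightarrow> real) \<Rightarrow> ('v \<Rightarrow> real) \<Rightarrow> ('v \<Rightarrow> real) \<Rightarrow> 'v \<Rightarrow> real"
  where "laplacian G \<omega> \<mu> u x =
    (1 / \<mu> x) * (\<Sum>y \<in> {y. (x, y) \<in> parcs G}. \<omega> x y * (u y - u x))"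

definition sinh_gordon_solution ::
  "'v pair_pre_digraph \<Rightarrow> ('v \<Rightarrow> 'v \<Rightarrow> real) \<Rightarrow> ('v \<Rightarrow> real) \<Rightarrow>
   ('v \<Rightarrow> real) \<Rightarrow> ('v \<Rightarrow> real) \<Rightarrow> real \<Rightarrow> ('v \<Rightarrow> real) \<Rightarrow> bool"
  where "sinh_gordon_solution G \<omega> \<mu> hp hm c u \<longleftrightarrow>
    (\<forall>x \<in> pverts G. - laplacian G \<omega> \<mu> u x = hp x * exp (u x) + hm x * exp (- u x) - c)"

end

theory Submission
  imports Defs
begin

text \<open>
  Suppose \<open>\<bar>u\<bar>\<close> has maximum \<open>M\<close> and \<open>u = M\<close> at some vertex.  At a vertex \<open>x\<close> where
  \<open>M - u x\<close> is bounded, the equation balances \<open>hp x * exp (u x)\<close>, which is exponential in \<open>M\<close>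
  if \<open>hp x \<noteq> 0\<close>, against terms of at most linear growth.  So either \<open>M\<close> is bounded, or
  \<open>hp x = 0\<close> and then \<open>laplacian G \<omega> \<mu> u x\<close> is bounded, whence \<open>M - u y\<close> is bounded at
  all neighbours \<open>y\<close> as well.  By connectedness \<open>M - u\<close> is bounded everywhere, in particular
  at a vertex with \<open>hp \<noteq> 0\<close>.  If instead \<open>u = -M\<close> somewhere, replace \<open>u\<close> by \<open>-u\<close>, which
  exchanges the roles of \<open>hp\<close> and \<open>hm\<close>.
\<close>

text \<open>For \<open>M > 1\<close>, use \<open>exp M \<ge> M\<^sup>2 / 2\<close> and
  \<open>b \<le> b * M\<close>; then one factor \<open>M\<close> cancels. The bound depends only on
  \<open>k\<close>, \<open>a\<close>, \<open>b\<close>, which is what makes it uniform over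
  solutions.\<close>

lemma exp_le_linear_imp_bounded:
  fixes k a b M :: real
  assumes "k > 0" "a \<ge> 0" "b \<ge> 0" "M \<ge> 0" and "k * exp M \<le> a * M + b"
  shows "M \<le> max 1 (2 * (a + b) / k)"
proof (cases "M \<le> 1")
  case False
  have "M\<^sup>2 / 2 \<le> exp M"
    using exp_lower_Taylor_quadratic[OF \<open>M \<ge> 0\<close>] \<open>M \<ge> 0\<close> by linarith
  then have "k * (M\<^sup>2 / 2) \<le> k * exp M"
    using \<open>k > 0\<close> by (simp add: mult_left_mono)
  also have "\<dots> \<le> a * M + b * M"
    using assms(5) mult_left_mono[of 1 M b] False \<open>b \<ge> 0\<close> by simp
  finally have "M * (k * M) \<le> M * (2 * (a + b))"
    by (simp add: power2_eq_square algebra_simps)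
  then have "k * M \<le> 2 * (a + b)"
    using False by (simp add: mult_le_cancel_left)
  then show ?thesis
    using \<open>k > 0\<close> by (simp add: le_max_iff_disj pos_le_divide_eq mult.commute)
qed simp

lemma finite_family_bounded:
  fixes P :: "'a \<Rightarrow> real \<Rightarrow> bool"
  assumes "finite A" and "\<And>x. x \<in> A \<Longrightarrow> \<exists>C. P x C"
    and mono: "\<And>x C D. P x C \<Longrightarrow> C \<le> D \<Longrightarrow> P x D"
  shows "\<exists>C. \<forall>x \<in> A. P x C"
proof -
  obtain f where f: "\<And>x. x \<in> A \<Longrightarrow> P x (f x)"
    using assms(2) by metis
  have "\<forall>x \<in> A. P x (Max (f ` A))"
    using f mono Max_ge \<open>finite A\<close> by (metis finite_imageI imageI)
  then show ?thesis ..
qed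

context connected_weighted_graph
begin

lemma pverts_nonempty: "pverts G \<noteq> {}"
  using graph_connected
  by (auto simp: Digraph_Component.connected_def strongly_connected_def)

lemma vertices_rtrancl:
  assumes "x \<in> pverts G" "y \<in> pverts G"
  shows "(x, y) \<in> (parcs G)\<^sup>*"
proof -
  \<comment> \<open>Connectedness is strong connectedness of the symmetric closure; as the arcs are
    already symmetric, reachability is the same in both.\<close>
  have "x \<rightarrow>\<^sup>*\<^bsub>with_proj G\<^esub> y"
    using graph_connected assms reachable_mk_symmetric_eq pair_sym_arcs
    by (simp add: Digraph_Component.connected_def strongly_connected_def)
  then show ?thesis
    by (auto dest: reachable_rtranclI)
qed

abbreviation nbrs :: "'v \<Rightarrow> 'v set" where
  "nbrs x \<equiv> {y. (x, y) \<in> parcs G}"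

lemma nbrs_subset: "nbrs x \<subseteq> pverts G"
  using arc_fst_in_verts arc_snd_in_verts by fastforce

lemma finite_nbrs: "finite (nbrs x)"
  using finite_subset[OF nbrs_subset] finite_verts by simp

lemma weight_nbr_pos: "y \<in> nbrs x \<Longrightarrow> \<omega> x y > 0"
  using weight_pos_iff in_arcsD1 in_arcsD2 by auto

lemma sum_weights_nonneg: "(\<Sum>y \<in> nbrs x. \<omega> x y) \<ge> 0"
  by (rule sum_nonneg) (use weight_nbr_pos in force)

lemma measure_times_laplacian:
  "x \<in> pverts G \<Longrightarrow> \<mu> x * laplacian G \<omega> \<mu> u x = (\<Sum>y \<in> nbrs x. \<omega> x y * (u y - u x))"
  using measure_pos[of x] by (simp add: laplacian_def)

text \<open>Each difference is at most \<open>2 * M\<close>. Growth linear in \<open>M\<close>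
  suffices, since this competes with an exponential in \<open>M\<close>.\<close>

lemma abs_laplacian_le:
  assumes x: "x \<in> pverts G" and M: "\<And>y. y \<in> pverts G \<Longrightarrow> \<bar>u y\<bar> \<le> M"
  shows "\<mu> x * \<bar>laplacian G \<omega> \<mu> u x\<bar> \<le> (2 * (\<Sum>y \<in> nbrs x. \<omega> x y)) * M"
proof -
  have "\<bar>\<Sum>y \<in> nbrs x. \<omega> x y * (u y - u x)\<bar> \<le> (\<Sum>y \<in> nbrs x. \<bar>\<omega> x y * (u y - u x)\<bar>)"
    by (rule sum_abs)
  also have "\<dots> \<le> (\<Sum>y \<in> nbrs x. \<omega> x y * (2 * M))"
  proof (rule sum_mono)
    fix y assume y: "y \<in> nbrs x"
    then have "\<bar>u y - u x\<bar> \<le> 2 * M"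
      using M[OF x] M[of y] nbrs_subset by fastforce
    then show "\<bar>\<omega> x y * (u y - u x)\<bar> \<le> \<omega> x y * (2 * M)"
      using weight_nbr_pos[OF y] by (simp add: abs_mult)
  qed
  finally show ?thesis
    using measure_times_laplacian[OF x, of u] measure_pos[OF x]
    by (simp add: abs_mult sum_distrib_left sum_distrib_right algebra_simps flip: abs_mult_pos)
qed

text \<open>The Laplacian is odd in \<open>u\<close>. The signs of \<open>hp\<close>,
  \<open>hm\<close> and \<open>c\<close> are unrestricted, so the negated data are again
  admissible.\<close>

lemma solution_uminus:
  "sinh_gordon_solution G \<omega> \<mu> hp hm c u \<Longrightarrow>
   sinh_gordon_solution G \<omega> \<mu> (\<lambda>x. - hm x) (\<lambda>x. - hp x) (- c) (\<lambda>x. - u x)"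
proof -
  have "laplacian G \<omega> \<mu> (\<lambda>x. - u x) x = - laplacian G \<omega> \<mu> u x" for x
    by (simp add: laplacian_def right_diff_distrib sum_subtractf minus_divide_left)
  then show "sinh_gordon_solution G \<omega> \<mu> hp hm c u \<Longrightarrow> ?thesis"
    by (force simp: sinh_gordon_solution_def)
qed

lemma near_max_bounded:
  assumes x: "x \<in> pverts G" and "hp x \<noteq> 0"
  shows "\<exists>C. \<forall>u M. sinh_gordon_solution G \<omega> \<mu> hp hm c u \<longrightarrow>
    (\<forall>y \<in> pverts G. \<bar>u y\<bar> \<le> M) \<longrightarrow> M - u x \<le> D \<longrightarrow> M \<le> C"
proof -
  let ?W = "\<Sum>y \<in> nbrs x. \<omega> x y"
  \<comment> \<open>Coefficients of the equation multiplied by \<open>\<mu> x\<close>: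
    \<open>exp (- D)\<close> comes from \<open>u x \<ge> M - D\<close>, and \<open>exp D\<close>
    from \<open>- u x \<le> D - M \<le> D\<close>.\<close>
  define k a b where "k = \<mu> x * \<bar>hp x\<bar> * exp (- D)" and "a = 2 * ?W"
    and "b = \<mu> x * (\<bar>hm x\<bar> * exp D + \<bar>c\<bar>)"
  have \<mu>: "\<mu> x > 0"
    using measure_pos[OF x] .
  have "M \<le> max 1 (2 * (a + b) / k)"
    if sol: "sinh_gordon_solution G \<omega> \<mu> hp hm c u"
      and M: "\<And>y. y \<in> pverts G \<Longrightarrow> \<bar>u y\<bar> \<le> M" and D: "M - u x \<le> D" for u M
  proof (rule exp_le_linear_imp_bounded)
    show "k > 0"
      using \<mu> \<open>hp x \<noteq> 0\<close> by (simp add: k_def)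
    show "a \<ge> 0"
      using sum_weights_nonneg by (simp add: a_def)
    show "b \<ge> 0"
      using \<mu> by (simp add: b_def)
    show "M \<ge> 0"
      using M[OF x] by linarith
    have "hp x * exp (u x) = - laplacian G \<omega> \<mu> u x - hm x * exp (- u x) + c"
      using sol x by (simp add: sinh_gordon_solution_def)
    then have "\<bar>hp x * exp (u x)\<bar> \<le> \<bar>laplacian G \<omega> \<mu> u x\<bar> + \<bar>hm x * exp (- u x)\<bar> + \<bar>c\<bar>"
      by linarith
    then have "\<bar>hp x\<bar> * exp (u x) \<le> \<bar>laplacian G \<omega> \<mu> u x\<bar> + \<bar>hm x\<bar> * exp (- u x) + \<bar>c\<bar>"
      by (simp add: abs_mult)
    moreover have "\<bar>hm x\<bar> * exp (- u x) \<le> \<bar>hm x\<bar> * exp D"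
      using D \<open>M \<ge> 0\<close> by (intro mult_left_mono) auto
    moreover have "\<bar>hp x\<bar> * exp (M - D) \<le> \<bar>hp x\<bar> * exp (u x)"
      using D by (intro mult_left_mono) auto
    ultimately have
      "\<bar>hp x\<bar> * exp (M - D) \<le> \<bar>laplacian G \<omega> \<mu> u x\<bar> + (\<bar>hm x\<bar> * exp D + \<bar>c\<bar>)"
      by linarith
    from mult_left_mono[OF this less_imp_le[OF \<mu>]]
    have "\<mu> x * (\<bar>hp x\<bar> * exp (M - D)) \<le> \<mu> x * \<bar>laplacian G \<omega> \<mu> u x\<bar> + b"
      by (simp add: b_def algebra_simps)
    also have "\<dots> \<le> a * M + b"
      using abs_laplacian_le[OF x, of u M] M by (simp add: a_def)
    finally show "k * exp M \<le> a * M + b"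
      by (simp add: k_def mult.assoc flip: exp_add)
  qed
  then show ?thesis
    by blast
qed

text \<open>One step of propagation of the deficit \<open>M - u\<close> along an edge. If
  \<open>hp x \<noteq> 0\<close>, then \<open>M\<close> itself is bounded; otherwise the equation at
  \<open>x\<close> has no term growing with \<open>M\<close>.\<close>

lemma deficit_nbr_bounded:
  assumes y: "y \<in> nbrs x"
  shows "\<exists>C. \<forall>u M. sinh_gordon_solution G \<omega> \<mu> hp hm c u \<longrightarrow>
    (\<forall>z \<in> pverts G. \<bar>u z\<bar> \<le> M) \<longrightarrow> M - u x \<le> D \<longrightarrow> M - u y \<le> C"
proof (cases "hp x = 0")
  have xV: "x \<in> pverts G" and yV: "y \<in> pverts G"
    using y in_arcsD1 in_arcsD2 by auto
  case False
  then obtain C where C: "\<And>u M. sinh_gordon_solution G \<omega> \<mu> hp hm c u \<Longrightarrow>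
    \<forall>z \<in> pverts G. \<bar>u z\<bar> \<le> M \<Longrightarrow> M - u x \<le> D \<Longrightarrow> M \<le> C"
    using near_max_bounded[of x hp hm c D] xV by blast
  \<comment> \<open>Here \<open>- u y \<le> M\<close> and \<open>M \<le> C\<close>.\<close>
  have "M - u y \<le> 2 * C"
    if "sinh_gordon_solution G \<omega> \<mu> hp hm c u" and M: "\<forall>z \<in> pverts G. \<bar>u z\<bar> \<le> M"
      and "M - u x \<le> D" for u M
    using C[OF that] M yV by fastforce
  then show ?thesis
    by blast
next
  have x: "x \<in> pverts G"
    using y in_arcsD1 by auto
  case True
  let ?W = "\<Sum>z \<in> nbrs x. \<omega> x z"
  have \<mu>: "\<mu> x > 0"
    using measure_pos[OF x] .
  have "M - u y \<le> (?W * D + \<mu> x * (\<bar>hm x\<bar> * exp D + \<bar>c\<bar>)) / \<omega> x y"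
    if sol: "sinh_gordon_solution G \<omega> \<mu> hp hm c u"
      and M: "\<forall>z \<in> pverts G. \<bar>u z\<bar> \<le> M" and D: "M - u x \<le> D" for u M
  proof -
    have "M \<ge> 0"
      using M x by fastforce
    \<comment> \<open>All deficits are nonnegative, so a single weighted one is at most their
      sum.\<close>
    have "\<omega> x y * (M - u y) \<le> (\<Sum>z \<in> nbrs x. \<omega> x z * (M - u z))"
    proof (rule member_le_sum[OF y _ finite_nbrs])
      fix z assume z: "z \<in> nbrs x - {y}"
      then have "z \<in> pverts G"
        using nbrs_subset by blast
      then have "M - u z \<ge> 0"
        using M by fastforce
      then show "\<omega> x z * (M - u z) \<ge> 0"
        using weight_nbr_pos[of z x] z by auto
    qed
    \<comment> \<open>Split \<open>M - u z = (M - u x) - (u z - u x)\<close>.\<close>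
    also have "\<dots> = ?W * (M - u x) - \<mu> x * laplacian G \<omega> \<mu> u x"
      by (simp add: measure_times_laplacian[OF x] sum_distrib_left sum_distrib_right
          algebra_simps sum_subtractf sum.distrib)
    also have "\<dots> = ?W * (M - u x) + \<mu> x * (hm x * exp (- u x) - c)"
      using sol x True by (simp add: sinh_gordon_solution_def flip: mult_minus_right)
    also have "\<dots> \<le> ?W * D + \<mu> x * (\<bar>hm x\<bar> * exp D + \<bar>c\<bar>)"
    proof (intro add_mono mult_left_mono D)
      show "?W \<ge> 0"
        by (rule sum_weights_nonneg)
      have "hm x * exp (- u x) \<le> \<bar>hm x\<bar> * exp D"
        using D \<open>M \<ge> 0\<close> by (intro mult_mono) auto
      then show "hm x * exp (- u x) - c \<le> \<bar>hm x\<bar> * exp D + \<bar>c\<bar>"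
        by linarith
    qed (use \<mu> in simp)
    finally show ?thesis
      using weight_nbr_pos[OF y] by (simp add: pos_le_divide_eq mult.commute)
  qed
  then show ?thesis
    by blast
qed

text \<open>Iterate the one-step bound along a path from \<open>x0\<close>, where the deficit is
  \<open>0\<close>. The constant may depend on the path, but not on \<open>u\<close> or
  \<open>M\<close>.\<close>

lemma deficit_bounded:
  assumes "(x0, x) \<in> (parcs G)\<^sup>*"
  shows "\<exists>C. \<forall>u M. sinh_gordon_solution G \<omega> \<mu> hp hm c u \<longrightarrow>
    (\<forall>z \<in> pverts G. \<bar>u z\<bar> \<le> M) \<longrightarrow> u x0 = M \<longrightarrow> M - u x \<le> C"
  using assms
proof induction
  case base
  show ?case
    by (intro exI[of _ 0]) simp
next
  case (step x y)
  from step.IH obtain D where "\<And>u M. sinh_gordon_solution G \<omega> \<mu> hp hm c u \<Longrightarrow>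
    \<forall>z \<in> pverts G. \<bar>u z\<bar> \<le> M \<Longrightarrow> u x0 = M \<Longrightarrow> M - u x \<le> D"
    by blast
  with deficit_nbr_bounded[of y x hp hm c D] step.hyps(2) show ?case
    by (metis mem_Collect_eq)
qed

lemma sup_norm_bounded_if_attained_above:
  assumes "\<exists>x \<in> pverts G. hp x \<noteq> 0"
  shows "\<exists>C. \<forall>x0 \<in> pverts G. \<forall>u. sinh_gordon_solution G \<omega> \<mu> hp hm c u \<longrightarrow>
    (\<forall>z \<in> pverts G. \<bar>u z\<bar> \<le> u x0) \<longrightarrow> u x0 \<le> C"
\<comment> \<open>The bound for a fixed \<open>x0\<close> depends on \<open>x0\<close>; finiteness
  of the vertex set allows one constant for all possible maximum points.\<close>
proof (rule finite_family_bounded)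
  fix x0 assume "x0 \<in> pverts G"
  obtain x where x: "x \<in> pverts G" "hp x \<noteq> 0"
    using assms by blast
  obtain D where D: "\<And>u M. sinh_gordon_solution G \<omega> \<mu> hp hm c u \<Longrightarrow>
    \<forall>z \<in> pverts G. \<bar>u z\<bar> \<le> M \<Longrightarrow> u x0 = M \<Longrightarrow> M - u x \<le> D"
    using deficit_bounded[OF vertices_rtrancl[OF \<open>x0 \<in> pverts G\<close> x(1)]] by blast
  obtain C where "\<And>u M. sinh_gordon_solution G \<omega> \<mu> hp hm c u \<Longrightarrow>
    \<forall>z \<in> pverts G. \<bar>u z\<bar> \<le> M \<Longrightarrow> M - u x \<le> D \<Longrightarrow> M \<le> C"
    using near_max_bounded[of x hp hm c D] x by blast
  with D show "\<exists>C. \<forall>u. sinh_gordon_solution G \<omega> \<mu> hp hm c u \<longrightarrow>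
      (\<forall>z \<in> pverts G. \<bar>u z\<bar> \<le> u x0) \<longrightarrow> u x0 \<le> C"
    by blast
qed (use finite_verts in \<open>auto intro: order_trans\<close>)

end

theorem theorem2p1:
  fixes G :: "'v pair_pre_digraph"
    and \<omega> :: "'v \<Rightarrow> 'v \<Rightarrow> real"
    and \<mu> hp hm :: "'v \<Rightarrow> real"
    and c :: real
  assumes "connected_weighted_graph G \<omega> \<mu>"
    and "\<exists>x \<in> pverts G. hp x \<noteq> 0"
    and "\<exists>x \<in> pverts G. hm x \<noteq> 0"
  shows "\<exists>C :: real. \<forall>u :: 'v \<Rightarrow> real.
           sinh_gordon_solution G \<omega> \<mu> hp hm c u \<longrightarrow>
           Max ((\<lambda>x. \<bar>u x\<bar>) ` pverts G) \<le> C"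
proof -
  interpret connected_weighted_graph G \<omega> \<mu>
    by fact
  obtain C1 where C1: "\<And>x0 u. x0 \<in> pverts G \<Longrightarrow> sinh_gordon_solution G \<omega> \<mu> hp hm c u \<Longrightarrow>
    \<forall>z \<in> pverts G. \<bar>u z\<bar> \<le> u x0 \<Longrightarrow> u x0 \<le> C1"
    using sup_norm_bounded_if_attained_above[of hp hm c] assms(2) by blast
  obtain C2 where C2: "\<And>x0 u. x0 \<in> pverts G \<Longrightarrow>
    sinh_gordon_solution G \<omega> \<mu> (\<lambda>x. - hm x) (\<lambda>x. - hp x) (- c) u \<Longrightarrow>
    \<forall>z \<in> pverts G. \<bar>u z\<bar> \<le> u x0 \<Longrightarrow> u x0 \<le> C2"
    using sup_norm_bounded_if_attained_above[of "\<lambda>x. - hm x" "\<lambda>x. - hp x" "- c"] assms(3)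
    by auto
  have "Max ((\<lambda>x. \<bar>u x\<bar>) ` pverts G) \<le> max C1 C2"
    if sol: "sinh_gordon_solution G \<omega> \<mu> hp hm c u" for u
  proof -
    let ?M = "Max ((\<lambda>x. \<bar>u x\<bar>) ` pverts G)"
    have "?M \<in> (\<lambda>x. \<bar>u x\<bar>) ` pverts G"
      using finite_verts pverts_nonempty by (intro Max_in) auto
    then obtain x0 where x0: "x0 \<in> pverts G" "?M = \<bar>u x0\<bar>"
      by auto
    then have le: "\<forall>z \<in> pverts G. \<bar>u z\<bar> \<le> \<bar>u x0\<bar>"
      using finite_verts by (metis Max_ge finite_imageI imageI)
    show ?thesis
    \<comment> \<open>The sign at a maximum point of \<open>\<bar>u\<bar>\<close> decides whether
      \<open>u\<close> or \<open>-u\<close> attains the maximum there, and so whether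
      \<open>C1\<close> or \<open>C2\<close> applies.\<close>
    proof (cases "u x0 \<ge> 0")
      case True
      then show ?thesis
        using C1[OF x0(1) sol] le x0(2) by auto
    next
      case False
      then show ?thesis
        using C2[OF x0(1) solution_uminus[OF sol]] le x0(2) by auto
    qed
  qed
  then show ?thesis
    by blast
qed

end
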